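(* Let $a,b,c\in\mathbb{N}$ with $a\le b\le c$ and $3a\ge b+c$. Then $f(a,b,c)\le \left\lfloor \frac{a+b+c}{2}\right\rfloor$.
   Context: $\mathbb{N}$ denotes the positive integers and $[n]=\{1,\dots,n\}$. For $a,b,c\in\mathbb{N}$, $f(a,b,c)$ denotes the metric dimension of the Cartesian product $K_a\times K_b\times K_c$ of complete graphs (vertex set $[a]\times[b]\times[c]$, two triples adjacent iff they differ in exactly one coordinate); the metric dimension of a graph is the minimum size of a vertex set $U$ such that every vertex is uniquely determined by its vector of distances to the vertices of $U$. Equivalently, $f(a,b,c)$ is the minimum cardinality of a set $Q\subseteq[a]\times[b]\times[c]$ such that for all distinct $s,s'$ there is $q\in Q$ with $g(s,q)\neq g(s',q)$, where $g(s,q)$ is the number of indices $i\in[3]$ with $s_i=q_i$. *)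

theory Defs
  imports "Graph_Theory.Graph_Theory"
begin

definition complete_graph :: "nat \<Rightarrow> nat pair_pre_digraph" where
  "complete_graph n =
     \<lparr> pverts = {1..n}, parcs = {(i, j). i \<in> {1..n} \<and> j \<in> {1..n} \<and> i \<noteq> j} \<rparr>"

definition cartesian_graph_product ::
  "'a pair_pre_digraph \<Rightarrow> 'b pair_pre_digraph \<Rightarrow> ('a \<times> 'b) pair_pre_digraph" where
  "cartesian_graph_product G H =
     \<lparr> pverts = pverts G \<times> pverts H,
       parcs = {((u, v), (u', v')).
          ((u, u') \<in> parcs G \<and> v = v' \<and> v \<in> pverts H) \<or>
          (u = u' \<and> u \<in> pverts G \<and> (v, v') \<in> parcs H)} \<rparr>"

definition K3prod :: "nat \<Rightarrow> nat \<Rightarrow> nat \<Rightarrow> (nat \<times> nat \<times> nat) pair_pre_digraph" where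
  "K3prod a b c =
     cartesian_graph_product (complete_graph a)
       (cartesian_graph_product (complete_graph b) (complete_graph c))"

text \<open>Distance is the shortest-path distance for unit arc costs; it is infinite between
  vertices in different components. The constant below only has its intended meaning for
  well-formed graphs, since that is what its defining locale assumes.\<close>

definition graph_dist :: "'a pair_pre_digraph \<Rightarrow> 'a \<Rightarrow> 'a \<Rightarrow> ereal" where
  "graph_dist G u v = wf_digraph.\<mu> (with_proj G) (\<lambda>_. 1) u v"

definition resolving_set :: "'a pair_pre_digraph \<Rightarrow> 'a set \<Rightarrow> bool" where
  "resolving_set G U \<longleftrightarrow> U \<subseteq> pverts G \<and>
     (\<forall>s \<in> pverts G. \<forall>t \<in> pverts G.
        (\<forall>q \<in> U. graph_dist G s q = graph_dist G t q) \<longrightarrow> s = t)"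

text \<open>For a finite graph the minimum is attained, because the full vertex set is resolving
  (see \<open>metric_dimension_attained\<close>).\<close>

definition metric_dimension :: "'a pair_pre_digraph \<Rightarrow> nat" where
  "metric_dimension G = (LEAST k. \<exists>U. finite U \<and> resolving_set G U \<and> card U = k)"

lemma pverts_K3prod: "pverts (K3prod a b c) = {1..a} \<times> {1..b} \<times> {1..c}"
  by (simp add: K3prod_def cartesian_graph_product_def complete_graph_def)

lemma adjacent_K3prod_iff:
  "((x, y, z), (x', y', z')) \<in> parcs (K3prod a b c) \<longleftrightarrow>
     (x, y, z) \<in> pverts (K3prod a b c) \<and> (x', y', z') \<in> pverts (K3prod a b c) \<and>
     of_bool (x \<noteq> x') + of_bool (y \<noteq> y') + of_bool (z \<noteq> z') = (1 :: nat)"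
  by (cases "x = x'"; cases "y = y'"; cases "z = z'")
    (simp_all add: K3prod_def cartesian_graph_product_def complete_graph_def conj_ac)

lemma pair_graph_complete_graph: "pair_graph (complete_graph n)"
proof
  show "finite (parcs (complete_graph n))"
    by (rule finite_subset[of _ "{1..n} \<times> {1..n}"]) (auto simp: complete_graph_def)
  show "symmetric (with_proj (complete_graph n))"
    unfolding symmetric_def with_proj_simps by (rule symI) (simp add: complete_graph_def)
qed (auto simp: complete_graph_def)

lemma pair_graph_cartesian_graph_product:
  assumes "pair_graph G" "pair_graph H"
  shows "pair_graph (cartesian_graph_product G H)"
proof -
  interpret G: pair_graph G by (rule assms(1))
  interpret H: pair_graph H by (rule assms(2))
  let ?P = "cartesian_graph_product G H"
  have arc: "fst e \<in> pverts ?P \<and> snd e \<in> pverts ?P \<and> fst e \<noteq> snd e"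
    if "e \<in> parcs ?P" for e
  proof -
    obtain u v u' v' where e: "e = ((u, v), (u', v'))"
      by (metis prod.collapse)
    from that have "((u, u') \<in> parcs G \<and> v = v' \<and> v \<in> pverts H) \<or>
        (u = u' \<and> u \<in> pverts G \<and> (v, v') \<in> parcs H)"
      by (simp add: e cartesian_graph_product_def)
    then show ?thesis
      using G.in_arcsD1 G.in_arcsD2 H.in_arcsD1 H.in_arcsD2
        G.no_loops'[of u u'] H.no_loops'[of v v']
      by (simp add: e cartesian_graph_product_def) blast
  qed
  have fin: "finite (pverts ?P)"
    by (simp add: cartesian_graph_product_def)
  show ?thesis
  proof
    have "parcs ?P \<subseteq> pverts ?P \<times> pverts ?P"
      using arc by (intro subsetI) (metis SigmaI prod.collapse)
    then show "finite (parcs ?P)"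
      by (rule finite_subset) (simp add: fin)
    show "symmetric (with_proj ?P)"
      unfolding symmetric_def with_proj_simps
    proof (rule symI)
      fix s t assume "(s, t) \<in> parcs ?P"
      then show "(t, s) \<in> parcs ?P"
        using G.arcs_symmetric H.arcs_symmetric
        by (cases s; cases t) (simp add: cartesian_graph_product_def, blast)
    qed
  qed (use arc fin in blast)+
qed

lemma pair_graph_K3prod: "pair_graph (K3prod a b c)"
  unfolding K3prod_def
  by (intro pair_graph_cartesian_graph_product pair_graph_complete_graph)

lemma graph_dist_eq_0_iff:
  assumes "pair_graph G" "u \<in> pverts G" "v \<in> pverts G"
  shows "graph_dist G u v = 0 \<longleftrightarrow> u = v"
proof -
  interpret pair_graph G by (rule assms(1))
  have d: "graph_dist G u v = (INF p\<in>{p. awalk u p v}. ereal (awalk_cost (\<lambda>_. 1) p))"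
    by (simp add: graph_dist_def \<mu>_def)
  have len: "awalk_cost (\<lambda>_. 1) p = real (length p)" for p
    by (induction p) simp_all
  show ?thesis
  proof
    assume "u = v"
    then have "awalk u [] v"
      using assms(2) by (simp add: awalk_Nil_iff)
    then have "graph_dist G u v \<le> 0"
      unfolding d by (intro INF_lower2[of "[]"]) simp_all
    moreover have "0 \<le> graph_dist G u v"
      unfolding d by (rule INF_greatest) (simp add: len)
    ultimately show "graph_dist G u v = 0" by simp
  next
    assume z: "graph_dist G u v = 0"
    show "u = v"
    proof (rule ccontr)
      assume ne: "u \<noteq> v"
      have "1 \<le> graph_dist G u v"
        unfolding d
      proof (rule INF_greatest)
        fix p assume "p \<in> {p. awalk u p v}"
        then have "p \<noteq> []"
          using ne by (auto simp: awalk_Nil_iff)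
        then show "1 \<le> ereal (awalk_cost (\<lambda>_. 1) p)"
          by (cases p) (simp_all add: len)
      qed
      with z show False by simp
    qed
  qed
qed

lemma resolving_set_pverts: "pair_graph G \<Longrightarrow> resolving_set G (pverts G)"
  unfolding resolving_set_def
proof (intro conjI ballI impI)
  fix s t
  assume "pair_graph G" "s \<in> pverts G" "t \<in> pverts G"
    and "\<forall>q \<in> pverts G. graph_dist G s q = graph_dist G t q"
  then show "s = t"
    using graph_dist_eq_0_iff[of G t t] graph_dist_eq_0_iff[of G s t] by simp
qed simp

lemma metric_dimension_attained:
  assumes "pair_graph G"
  shows "\<exists>U. finite U \<and> resolving_set G U \<and> card U = metric_dimension G"
proof -
  interpret pair_graph G by (rule assms)
  have "\<exists>k U. finite U \<and> resolving_set G U \<and> card U = k"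
    using resolving_set_pverts[OF assms] pair_finite_verts by blast
  then show ?thesis
    unfolding metric_dimension_def by (rule LeastI_ex)
qed

end

theory Submission
  imports Defs
begin

text \<open>
  Index a set of \<open>k\<close> landmarks by a set \<open>V\<close>; the three coordinates partition \<open>V\<close> into \<open>a\<close>, \<open>b\<close> and \<open>c\<close>
  blocks, and distances to a triple see the sum of the indicator functions of the three blocks
  it selects. Taking blocks of size at most two, the blocks of size two are the edges of a properly
  edge-coloured graph (red, green, blue for the three coordinates); \<open>2 k = a + b + c\<close>
  means that there are as many edges as vertices, and a colour class being a matching of \<open>k - a\<close>
  edges needs \<open>k \<le> 2 a\<close>, which is where \<open>b + c \<le> 3 a\<close> enters. So let the graph be
  2-regular, every vertex missing exactly one colour. Two selections with the same sum force one of a few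
  local configurations in the graph. These are avoided by at most one two-coloured even cycle
  for each pair of colours when \<open>k\<close> is even; when \<open>k\<close> is odd, the red-green cycle is replaced by an odd
  cycle with a single blue edge. The only failure is three 2-cycles (double edges), i.e.
  \<open>a = b = c = 4\<close>, where an explicit set is used. All these sets still resolve when one more value,
  used by no landmark, is allowed in the last coordinate, which settles odd \<open>a + b + c\<close>.
\<close>

section \<open>Distances in the product of three complete graphs\<close>

definition agree :: "nat \<times> nat \<times> nat \<Rightarrow> nat \<times> nat \<times> nat \<Rightarrow> nat" where
  "agree s q = of_bool (fst s = fst q) + of_bool (fst (snd s) = fst (snd q)) +
     of_bool (snd (snd s) = snd (snd q))"

text \<open>An arc changes exactly one coordinate, so a step of a walk gains at most one agreement
  with the target; correcting wrong coordinates one at a time attains this bound.\<close>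

lemma graph_dist_K3prod:
  assumes u: "u \<in> pverts (K3prod a b c)" and v: "v \<in> pverts (K3prod a b c)"
  shows "graph_dist (K3prod a b c) u v = ereal (3 - real (agree u v))"
proof -
  let ?G = "K3prod a b c"
  interpret pair_graph ?G by (rule pair_graph_K3prod)
  have adj: "(s, t) \<in> parcs ?G \<longleftrightarrow> s \<in> pverts ?G \<and> t \<in> pverts ?G \<and> agree s t = 2" for s t
    by (cases s; cases t) (auto simp: adjacent_K3prod_iff agree_def of_bool_def split: if_splits)
  have len: "awalk_cost (\<lambda>_. 1) p = real (length p)" for p
    by (induction p) simp_all
  have d: "graph_dist ?G u v = (INF p\<in>{p. awalk u p v}. ereal (real (length p)))"
    by (simp add: graph_dist_def \<mu>_def len)
  have lower: "3 \<le> length p + agree w v" if "awalk w p v" for w p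
    using that
  proof (induction p arbitrary: w)
    case Nil
    then show ?case by (simp add: awalk_Nil_iff agree_def)
  next
    case (Cons e p)
    then have e: "(w, snd e) \<in> parcs ?G" and "awalk (snd e) p v"
      by (auto simp: awalk_Cons_iff)
    moreover have "agree (snd e) v \<le> agree w v + 1"
      using e unfolding adj by (auto simp: agree_def of_bool_def split: if_splits)
    ultimately show ?case using Cons.IH[of "snd e"] by simp
  qed
  have upper: "\<exists>p. awalk w p v \<and> length p + agree w v = 3"
    if "w \<in> pverts ?G" for w
    using that
  proof (induction "3 - agree w v" arbitrary: w)
    case 0
    then have "w = v"
      by (cases w; cases v) (auto simp: agree_def of_bool_def split: if_splits)
    then show ?case using v by (intro exI[of _ "[]"]) (simp add: awalk_Nil_iff agree_def)
  next
    case (Suc n)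
    obtain x y z x' y' z' where w: "w = (x, y, z)" and v': "v = (x', y', z')"
      by (cases w; cases v) auto
    define w' where "w' = (if x \<noteq> x' then (x', y, z) else if y \<noteq> y' then (x, y', z) else (x, y, z'))"
    have "w' \<in> pverts ?G" using Suc.prems v by (auto simp: w w'_def v' pverts_K3prod)
    moreover have "agree w' v = agree w v + 1" "agree w w' = 2"
      using Suc.hyps(2) by (auto simp: w v' w'_def agree_def)
    ultimately have "(w, w') \<in> parcs ?G" "n = 3 - agree w' v"
      using Suc adj by auto
    moreover obtain p where "awalk w' p v" "length p + agree w' v = 3"
      using Suc.hyps(1)[OF \<open>n = 3 - agree w' v\<close> \<open>w' \<in> pverts ?G\<close>] by blast
    ultimately show ?case
      using \<open>agree w' v = agree w v + 1\<close> Suc.prems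
      by (intro exI[of _ "(w, w') # p"]) (auto simp: awalk_Cons_iff)
  qed
  show ?thesis
    unfolding d
  proof (rule antisym)
    obtain p where "awalk u p v" "length p + agree u v = 3" using upper[OF u] by blast
    then show "(INF p\<in>{p. awalk u p v}. ereal (real (length p))) \<le> ereal (3 - real (agree u v))"
      by (intro INF_lower2[of p]) auto
  next
    show "ereal (3 - real (agree u v)) \<le> (INF p\<in>{p. awalk u p v}. ereal (real (length p)))"
    proof (rule INF_greatest)
      fix p assume "p \<in> {p. awalk u p v}"
      then have "3 \<le> length p + agree u v" using lower by blast
      then show "ereal (3 - real (agree u v)) \<le> ereal (real (length p))" by simp
    qed
  qed
qed

text \<open>Membership of \<open>U\<close> in the box is kept separate, so that the box can gain a
  value in the last coordinate that no landmark takes.\<close>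

definition landmarks :: "nat \<Rightarrow> nat \<Rightarrow> nat \<Rightarrow> (nat \<times> nat \<times> nat) set \<Rightarrow> bool" where
  "landmarks a b c U \<longleftrightarrow> (\<forall>s \<in> {1..a} \<times> {1..b} \<times> {1..c}. \<forall>t \<in> {1..a} \<times> {1..b} \<times> {1..c}.
     (\<forall>q\<in>U. agree s q = agree t q) \<longrightarrow> s = t)"

lemma metric_dimension_K3prod_le:
  assumes "U \<subseteq> {1..a} \<times> {1..b} \<times> {1..c}" "landmarks a b c U"
  shows "metric_dimension (K3prod a b c) \<le> card U"
proof -
  have "resolving_set (K3prod a b c) U"
    unfolding resolving_set_def
  proof (intro conjI ballI impI)
    show "U \<subseteq> pverts (K3prod a b c)" using assms(1) by (simp add: pverts_K3prod)
    fix s t assume st: "s \<in> pverts (K3prod a b c)" "t \<in> pverts (K3prod a b c)"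
      and eq: "\<forall>q\<in>U. graph_dist (K3prod a b c) s q = graph_dist (K3prod a b c) t q"
    have "agree s q = agree t q" if "q \<in> U" for q
      using that eq st assms(1) graph_dist_K3prod[of s a b c q] graph_dist_K3prod[of t a b c q]
      by (auto simp: pverts_K3prod)
    with st assms(2) show "s = t" unfolding landmarks_def pverts_K3prod by blast
  qed
  moreover have "finite U" using assms(1) by (rule finite_subset) simp
  ultimately show ?thesis unfolding metric_dimension_def by (intro Least_le) blast
qed

lemma landmarks_mono:
  assumes "landmarks a b c U" "c' \<le> c"
  shows "landmarks a b c' U"
proof -
  have "{1..a} \<times> {1..b} \<times> {1..c'} \<subseteq> {1..a} \<times> {1..b} \<times> {1..c}" using assms(2) by auto
  then show ?thesis using assms(1) unfolding landmarks_def by blast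
qed

text \<open>The exceptional case \<open>a = b = c = 4\<close>, settled by evaluation on all 80
  triples. The value 5 of the last coordinate occurs in no landmark.\<close>

lemma landmarks_4_4_5:
  "landmarks 4 4 5 {(4,3,2),(3,2,2),(1,1,3),(2,4,1),(4,1,4),(2,2,2)}"
proof -
  let ?qs = "[(4,3,2),(3,2,2),(1,1,3),(2,4,1),(4,1,4),(2,2,2)] :: (nat \<times> nat \<times> nat) list"
  let ?box = "List.product [1,2,3,4] (List.product [1,2,3,4] [1,2,3,4,5]) :: (nat \<times> nat \<times> nat) list"
  \<comment> \<open>Six agreement counts, each at most 3, are read as base-4 digits.\<close>
  let ?code = "\<lambda>s. foldr (\<lambda>q n. agree s q + 4 * n) ?qs 0"
  have "distinct (map ?code ?box)" by (simp add: agree_def)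
  then have "inj_on ?code (set ?box)" by (simp only: distinct_map)
  moreover have "{1..4} \<times> {1..4} \<times> {1..5} \<subseteq> set ?box"
  proof -
    have "{1..4} = {1, 2, 3, 4::nat}" "{1..5} = {1, 2, 3, 4, 5::nat}" by auto
    then show ?thesis by simp
  qed
  ultimately have inj: "inj_on ?code ({1..4} \<times> {1..4} \<times> {1..5})" by (rule inj_on_subset)
  show ?thesis
    unfolding landmarks_def
  proof (intro ballI impI)
    fix s t :: "nat \<times> nat \<times> nat"
    assume st: "s \<in> {1..4} \<times> {1..4} \<times> {1..5}" "t \<in> {1..4} \<times> {1..4} \<times> {1..5}"
      and "\<forall>q\<in>{(4,3,2),(3,2,2),(1,1,3),(2,4,1),(4,1,4),(2,2,2)}. agree s q = agree t q"
    then have "?code s = ?code t" by simp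
    from inj_onD[OF inj this st] show "s = t" .
  qed
qed

section \<open>Ambiguous selections of blocks\<close>

datatype colour = Red | Green | Blue

text \<open>\<open>f i v\<close> is the label of the block of colour \<open>i\<close> containing \<open>v\<close>, and \<open>m v\<close> is the colour missing at \<open>v\<close>.
  Call an edge whose ends miss different colours a pivot. The assumptions from \<open>pivot_unique\<close> on list the
  minimal obstructions to resolvability; the last two concern an unused blue label only.\<close>
locale cycle_colouring =
  fixes V :: "'v set" and f :: "colour \<Rightarrow> 'v \<Rightarrow> 'l" and m :: "'v \<Rightarrow> colour"
  assumes single: "\<lbrakk>u \<in> V; v \<in> V; f (m v) u = f (m v) v\<rbrakk> \<Longrightarrow> u = v"
    and mate: "\<lbrakk>v \<in> V; i \<noteq> m v\<rbrakk> \<Longrightarrow> \<exists>u\<in>V. u \<noteq> v \<and> f i u = f i v"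
    and block_le_2: "\<lbrakk>u \<in> V; v \<in> V; w \<in> V; f i u = f i v; f i w = f i v\<rbrakk> \<Longrightarrow> u = v \<or> u = w \<or> v = w"
    and pivot_unique: "\<lbrakk>i \<noteq> j; j \<noteq> k; i \<noteq> k; u \<in> V; v \<in> V; u' \<in> V; v' \<in> V;
        f i u = f i v; m u = j; m v = k; f i u' = f i v'; m u' = j; m v' = k\<rbrakk> \<Longrightarrow> u = u'"
    and double: "\<lbrakk>i \<noteq> j; j \<noteq> k; i \<noteq> k; d \<in> V; d' \<in> V; d \<noteq> d'; f i d = f i d'; f j d = f j d';
        u \<in> V; v \<in> V; w \<in> V; u \<noteq> v; v \<noteq> w; f i u = f i v; f j v = f j w; m u = k; m w = k\<rbrakk>
        \<Longrightarrow> v = d \<or> v = d'"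
    and not_three_doubles: "\<lbrakk>i \<noteq> j; j \<noteq> k; i \<noteq> k;
        d1 \<in> V; d1' \<in> V; d1 \<noteq> d1'; f i d1 = f i d1'; f j d1 = f j d1';
        d2 \<in> V; d2' \<in> V; d2 \<noteq> d2'; f j d2 = f j d2'; f k d2 = f k d2';
        d3 \<in> V; d3' \<in> V; d3 \<noteq> d3'; f k d3 = f k d3'; f i d3 = f i d3'\<rbrakk> \<Longrightarrow> False"
    and no_double_pivot: "\<lbrakk>i \<noteq> j; j \<noteq> k; i \<noteq> k;
        u1 \<in> V; u2 \<in> V; u3 \<in> V; u4 \<in> V; u5 \<in> V; u1 \<noteq> u2; u4 \<noteq> u5;
        f k u1 = f k u2; f j u2 = f j u3; f i u3 = f i u4; f k u4 = f k u5;
        m u1 = i; m u2 = i; m u3 = k; m u4 = j; m u5 = j\<rbrakk> \<Longrightarrow> False"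
    and no_lone_blue_pivot: "\<lbrakk>i \<noteq> j; i \<noteq> Blue; j \<noteq> Blue;
        u1 \<in> V; u2 \<in> V; u3 \<in> V; u4 \<in> V; u1 \<noteq> u2; u3 \<noteq> u4;
        f i u1 = f i u2; f Blue u2 = f Blue u3; f j u3 = f j u4;
        m u1 = j; m u2 = j; m u3 = i; m u4 = i\<rbrakk> \<Longrightarrow> False"
    and no_pivot_and_double: "\<lbrakk>i \<noteq> j; i \<noteq> Blue; j \<noteq> Blue;
        u \<in> V; v \<in> V; f i u = f i v; m u = j; m v = Blue;
        d \<in> V; d' \<in> V; d \<noteq> d'; f i d = f i d'; f j d = f j d'\<rbrakk> \<Longrightarrow> False"
begin

definition block :: "colour \<Rightarrow> 'v set \<Rightarrow> bool" where
  "block i X \<longleftrightarrow> X \<subseteq> V \<and> (\<forall>u\<in>X. \<forall>v\<in>V. v \<in> X \<longleftrightarrow> f i v = f i u)"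

lemma blockD: "block i X \<Longrightarrow> u \<in> X \<Longrightarrow> v \<in> X \<Longrightarrow> f i u = f i v"
  unfolding block_def by blast

lemma block_in_V: "block i X \<Longrightarrow> u \<in> X \<Longrightarrow> u \<in> V"
  unfolding block_def by blast

lemma block_disjoint:
  assumes "block i X" "block i Y" "X \<noteq> Y"
  shows "X \<inter> Y = {}"
proof -
  have "Z = {u \<in> V. f i u = f i v}" if "block i Z" "v \<in> Z" for Z v
    using that unfolding block_def by blast
  then show ?thesis using assms by blast
qed

lemma block_single: "block i X \<Longrightarrow> v \<in> X \<Longrightarrow> m v = i \<Longrightarrow> X = {v}"
  using single unfolding block_def by blast

lemma block_eq: "block i X \<Longrightarrow> u \<in> X \<Longrightarrow> v \<in> X \<Longrightarrow> u \<noteq> v \<Longrightarrow> X = {u, v}"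
  using block_le_2[of _ u v i] unfolding block_def by blast

lemma block_mate: "block i X \<Longrightarrow> v \<in> X \<Longrightarrow> m v \<noteq> i \<Longrightarrow> \<exists>u\<in>X. u \<noteq> v"
  using mate[of v i] unfolding block_def by (metis subsetD)

lemma block_single_iff: "block i X \<Longrightarrow> v \<in> X \<Longrightarrow> m v = i \<longleftrightarrow> X = {v}"
  using block_single[of i X v] block_mate[of i X v] by auto

text \<open>A vertex misses only one colour, so a nonempty block of two colours is never a single
  vertex: it is a double edge.\<close>

lemma block_both: "block i X \<Longrightarrow> block j X \<Longrightarrow> i \<noteq> j \<Longrightarrow> v \<in> X \<Longrightarrow> \<exists>u\<in>X. u \<noteq> v"
  using block_mate[of i X v] block_mate[of j X v] by metis

end

text \<open>Meant for a selected block \<open>X\<close> covered by blocks \<open>Y\<close> and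
  \<open>Z\<close> of the opposite selection: a missing colour at \<open>v\<close> becomes emptiness
  of an intersection.\<close>

lemma eq_singleton_iff_disjoint:
  assumes "v \<in> X" "v \<in> Y" "v \<notin> Z" "X \<subseteq> Y \<union> Z" "\<And>u. u \<in> X \<Longrightarrow> u \<in> Y \<Longrightarrow> u = v"
  shows "X = {v} \<longleftrightarrow> X \<inter> Z = {}"
proof
  assume "X \<inter> Z = {}"
  then have "u = v" if "u \<in> X" for u using assms(4,5) that by blast
  then show "X = {v}" using assms(1) by blast
qed (use assms(3) in simp)

text \<open>\<open>L\<close> and \<open>R\<close> are the blocks selected by two indistinguishable triples that differ in all three
  coordinates. Only an unused blue label makes a block empty.\<close>
locale ambiguity = cycle_colouring V f m
  for V :: "'v set" and f :: "colour \<Rightarrow> 'v \<Rightarrow> 'l" and m :: "'v \<Rightarrow> colour" +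
  fixes L R :: "colour \<Rightarrow> 'v set"
  assumes L: "block i (L i)" and R: "block i (R i)"
    and L_disj: "i \<noteq> j \<Longrightarrow> L i \<inter> L j = {}"
    and R_disj: "i \<noteq> j \<Longrightarrow> R i \<inter> R j = {}"
    and LR_disj: "L i \<inter> R i = {}"
    and L_cover: "\<lbrakk>i \<noteq> j; j \<noteq> k; i \<noteq> k\<rbrakk> \<Longrightarrow> L i \<subseteq> R j \<union> R k"
    and R_cover: "\<lbrakk>i \<noteq> j; j \<noteq> k; i \<noteq> k\<rbrakk> \<Longrightarrow> R i \<subseteq> L j \<union> L k"
begin

lemma in_V: "v \<in> L i \<Longrightarrow> v \<in> V" "v \<in> R i \<Longrightarrow> v \<in> V"
  using L R block_in_V by blast+

lemma L_eq: "u \<in> L i \<Longrightarrow> v \<in> L i \<Longrightarrow> f i u = f i v"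
  using blockD[OF L] .

lemma R_eq: "u \<in> R i \<Longrightarrow> v \<in> R i \<Longrightarrow> f i u = f i v"
  using blockD[OF R] .

text \<open>A double edge \<open>L i = R j\<close> forces \<open>L k\<close> into \<open>R i\<close>
  and \<open>R k\<close> into \<open>L j\<close>. Then either a path with colours \<open>i\<close>,
  \<open>j\<close> has both ends missing \<open>k\<close>, against \<open>double\<close>, or each
  pair of colours has a double edge, against \<open>not_three_doubles\<close>.\<close>

lemma no_double:
  assumes ne: "\<And>i. L i \<noteq> {}" "\<And>i. R i \<noteq> {}"
    and ij: "i \<noteq> j" and d: "d \<in> L i" "d \<in> R j" "d' \<in> L i" "d' \<in> R j" "d \<noteq> d'"
  shows False
proof -
  obtain k where k: "j \<noteq> k" "i \<noteq> k" by (metis colour.distinct colour.exhaust)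
  have eq: "L i = R j"
    using block_eq[OF L d(1,3,5)] block_eq[OF R d(2,4,5)] by simp
  have Lk: "L k \<subseteq> R i" using L_cover[of k i j] L_disj[of k i] eq ij k by blast
  have Rk: "R k \<subseteq> L j" using R_cover[of k i j] R_disj[of k j] eq ij k by blast
  obtain u where u: "u \<in> L k" "u \<in> R i" using ne Lk by blast
  obtain w where w: "w \<in> R k" "w \<in> L j" using ne Rk by blast
  show False
  proof (cases "m u = k")
    case True
    then obtain y where y: "y \<in> R i" "y \<noteq> u" using block_mate[OF R u(2)] k by blast
    have Lku: "L k = {u}" using block_single[OF L u(1) True] .
    then have "y \<in> L j" using y R_cover[of i j k] ij k by blast
    have "w \<noteq> y" using w(1) y(1) R_disj[of i k] k by blast
    have "m w = k"
    proof (rule ccontr)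
      assume "m w \<noteq> k"
      then obtain w' where w': "w' \<in> R k" "w' \<noteq> w" using block_mate[OF R w(1)] by blast
      then have "w' \<noteq> y" "w' \<in> L j" using y(1) R_disj[of i k] k Rk by blast+
      with w' w \<open>y \<in> L j\<close> \<open>w \<noteq> y\<close> block_eq[OF L w(2) \<open>y \<in> L j\<close>] show False by blast
    qed
    then have "y = d \<or> y = d'"
      using double[of i j k d d' u y w] ij k d u y w True \<open>y \<in> L j\<close> \<open>w \<noteq> y\<close> in_V L_eq R_eq by metis
    then show False using y(1) d R_disj[of i j] ij by blast
  next
    case False
    then obtain u' where u': "u' \<in> L k" "u' \<noteq> u" using block_mate[OF L u(1)] by blast
    then have eq': "L k = R i"
      using block_eq[OF L u(1) u'(1)] block_eq[OF R u(2), of u'] Lk by blast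
    have "L j \<subseteq> R k" using L_cover[of j i k] L_disj[of j k] eq' ij k by blast
    then have "L j = R k" using Rk by blast
    then obtain w' where "w' \<in> L j" "w' \<in> R k" "w' \<noteq> w"
      using block_both[of j "L j" k w] L[of j] R[of k] k w by auto
    then show False
      using not_three_doubles[of i j k d d' w w' u u'] ij k d u w u' eq' in_V L_eq R_eq by metis
  qed
qed

text \<open>No two of the sets \<open>L i \<inter> R j\<close> (\<open>i \<noteq> j\<close>) in the same row or column are both empty, and
  \<open>L i \<inter> R k\<close>, \<open>L k \<inter> R j\<close> are not both empty. So none is empty (a 6-cycle), or exactly one
  (a path on five vertices), or \<open>L i \<inter> R j\<close> and \<open>L j \<inter> R i\<close> only (two pivots).\<close>
lemma no_nonempty_ambiguity:
  assumes ne: "\<And>i. L i \<noteq> {}" "\<And>i. R i \<noteq> {}"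
  shows False
proof -
  define Z where "Z i j \<longleftrightarrow> L i \<inter> R j = {}" for i j
  have row: "\<not> (Z i j \<and> Z i k)" if "i \<noteq> j" "j \<noteq> k" "i \<noteq> k" for i j k
    using ne(1)[of i] L_cover[OF that] unfolding Z_def by blast
  have col: "\<not> (Z i j \<and> Z k j)" if "i \<noteq> j" "j \<noteq> k" "i \<noteq> k" for i j k
    using ne(2)[of j] R_cover[of j i k] that unfolding Z_def by blast
  \<comment> \<open>By \<open>no_double\<close>, \<open>v\<close> is the only vertex of
    \<open>L i\<close> in \<open>R j\<close>; so \<open>L i\<close> is a single vertex exactly when
    its part in \<open>R k\<close> is empty.\<close>
  have mL: "m v = i \<longleftrightarrow> Z i k" if v: "v \<in> L i" "v \<in> R j" "i \<noteq> j" "j \<noteq> k" "i \<noteq> k" for v i j k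
  proof -
    have "u = v" if "u \<in> L i" "u \<in> R j" for u
      using no_double[OF ne v(3,1,2) that] by blast
    moreover have "v \<notin> R k" using R_disj[of j k] v by blast
    ultimately have "L i = {v} \<longleftrightarrow> L i \<inter> R k = {}"
      by (intro eq_singleton_iff_disjoint[OF v(1,2) _ L_cover[OF v(3-5)]])
    then show ?thesis using block_single_iff[OF L v(1)] Z_def by simp
  qed
  have mR: "m v = j \<longleftrightarrow> Z k j" if v: "v \<in> L i" "v \<in> R j" "i \<noteq> j" "j \<noteq> k" "i \<noteq> k" for v i j k
  proof -
    have "u = v" if "u \<in> L i" "u \<in> R j" for u
      using no_double[OF ne v(3,1,2) that] by blast
    moreover have "v \<notin> L k" using L_disj[of i k] v by blast
    moreover have "R j \<subseteq> L i \<union> L k" using R_cover[of j i k] v by simp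
    ultimately have "R j = {v} \<longleftrightarrow> R j \<inter> L k = {}"
      by (intro eq_singleton_iff_disjoint[OF v(2,1)])
    then show ?thesis using block_single_iff[OF R v(2)] Z_def by (simp add: Int_commute)
  qed
  have m3: "m v = k" if "v \<in> L i" "v \<in> R j" "i \<noteq> j" "j \<noteq> k" "i \<noteq> k" "\<not> Z i k" "\<not> Z k j" for v i j k
    using mL[OF that(1-5)] mR[OF that(1-5)] that
    by (metis colour.exhaust)
  \<comment> \<open>Otherwise a vertex of \<open>L i\<close> and \<open>R j\<close> would miss both
    \<open>i\<close> and \<open>j\<close>.\<close>
  have chain: "\<not> (Z i k \<and> Z k j)" if ijk: "i \<noteq> j" "j \<noteq> k" "i \<noteq> k" for i j k
  proof
    assume Z: "Z i k \<and> Z k j"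
    then obtain v where "v \<in> L i" "v \<in> R j" using row[OF ijk] Z_def by blast
    then show False using mL[of v i j k] mR[of v i j k] Z ijk by simp
  qed
  show False
  proof (cases "\<exists>i j. i \<noteq> j \<and> Z i j")
    case True
    then obtain i j k where ij: "i \<noteq> j" "Z i j" and k: "j \<noteq> k" "i \<noteq> k"
      by (metis colour.distinct colour.exhaust)
    have "\<not> Z i k" "\<not> Z k j" using row[of i j k] col[of i j k] ij k by auto
    then obtain ik kj where p: "ik \<in> L i" "ik \<in> R k" "kj \<in> L k" "kj \<in> R j"
      unfolding Z_def by blast
    have "\<not> Z j k" "\<not> Z k i" using chain[of i k j] chain[of k j i] ij k by auto
    then obtain jk ki where q: "jk \<in> L j" "jk \<in> R k" "ki \<in> L k" "ki \<in> R i"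
      unfolding Z_def by blast
    have m: "m ik = i" "m kj = j"
      using mL[of ik i k j] mR[of kj k j i] p ij k by auto
    have ne': "ik \<noteq> jk" "kj \<noteq> ki" "ik \<noteq> ki"
      using p q L_disj[of i j] R_disj[of i j] L_disj[of i k] ij k by auto
    show False
    proof (cases "Z j i")
      case True
      \<comment> \<open>Two edges of colour \<open>k\<close>, one in \<open>R k\<close> and one in
        \<open>L k\<close>, join a vertex missing \<open>i\<close> to one missing \<open>j\<close>;
        \<open>pivot_unique\<close> then identifies \<open>ik\<close> with
        \<open>ki\<close>.\<close>
      have "m jk = j" "m ki = i" using mL[of jk j k i] mR[of ki k i j] True q ij k by auto
      with m ne' show False
        using pivot_unique[of k i j ik jk ki kj] p q ij k in_V L_eq R_eq by metis
    next
      case False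
      \<comment> \<open>The path \<open>ik\<close>, \<open>jk\<close>, \<open>ji\<close>,
        \<open>ki\<close>, \<open>kj\<close> along \<open>R k\<close>, \<open>L j\<close>,
        \<open>R i\<close>, \<open>L k\<close> is the one excluded by
        \<open>no_double_pivot\<close>.\<close>
      then obtain ji where r: "ji \<in> L j" "ji \<in> R i" unfolding Z_def by blast
      have "m ji = k" using m3[of ji j i k] r ij k \<open>\<not> Z j k\<close> \<open>\<not> Z k i\<close> by auto
      moreover have "m jk = i" using m3[of jk j k i] q ij k False \<open>\<not> Z i k\<close> by auto
      moreover have "m ki = j" using m3[of ki k i j] q ij k False \<open>\<not> Z k j\<close> by auto
      ultimately show False
        using no_double_pivot[of i j k ik jk ji ki kj] m ne' p q r ij k in_V L_eq R_eq by metis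
    qed
  next
    case False
    then have Z: "\<And>i j. i \<noteq> j \<Longrightarrow> \<not> Z i j" by auto
    then have "\<not> Z Red Green" "\<not> Z Red Blue" "\<not> Z Green Red" "\<not> Z Blue Red" by simp_all
    then obtain u v u' v' where p: "u \<in> L Red" "u \<in> R Green" "v \<in> L Red" "v \<in> R Blue"
      "u' \<in> L Green" "u' \<in> R Red" "v' \<in> L Blue" "v' \<in> R Red"
      unfolding Z_def by blast
    \<comment> \<open>In the 6-cycle, the red edges \<open>L Red\<close> and \<open>R Red\<close>
      are both pivots with ends missing blue and green.\<close>
    have "m u = Blue" "m v = Green" "m u' = Blue" "m v' = Green"
      using m3[of u Red Green Blue] m3[of v Red Blue Green] m3[of u' Green Red Blue]
        m3[of v' Blue Red Green] p Z by auto
    then have "u = u'"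
      using pivot_unique[of Red Blue Green u v u' v'] p in_V L_eq R_eq by (metis colour.distinct)
    then show False using p L_disj[of Red Green] by blast
  qed
qed

text \<open>Without a left blue block, \<open>R i\<close> lies in \<open>L j\<close> and
  \<open>R j\<close> in \<open>L i\<close> for the other colours \<open>i\<close>, \<open>j\<close>.
  If \<open>R i\<close> is a single vertex, a path with a blue middle edge violates
  \<open>no_lone_blue_pivot\<close>; otherwise \<open>R i = L j\<close> is a double edge, which
  together with the pivot in \<open>L i\<close> violates \<open>no_pivot_and_double\<close>.\<close>

lemma no_ambiguity_blue_empty:
  assumes ne: "\<And>i. i \<noteq> Blue \<Longrightarrow> L i \<noteq> {}" "\<And>i. R i \<noteq> {}" and empty: "L Blue = {}"
  shows False
proof -
  obtain r where r: "r \<in> R Blue" using ne by blast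
  then have "r \<in> L Red \<or> r \<in> L Green" using R_cover[of Blue Red Green] by blast
  then obtain i j where ij: "i \<noteq> j" "i \<noteq> Blue" "j \<noteq> Blue" and ri: "r \<in> L i"
    by (metis colour.distinct)
  have Ri: "R i \<subseteq> L j" and Rj: "R j \<subseteq> L i"
    using R_cover[of i j Blue] R_cover[of j i Blue] ij empty by auto
  obtain p q where p: "p \<in> R j" "p \<in> L i" and q: "q \<in> R i" "q \<in> L j"
    using ne Ri Rj by blast
  have "p \<noteq> r" using r p R_disj[of j Blue] ij by blast
  have "R j = {p}"
    using block_eq[OF L p(2) ri \<open>p \<noteq> r\<close>] Rj p r R_disj[of j Blue] ij by blast
  then have mp: "m p = j" using block_single_iff[OF R p(1)] by simp
  show False
  proof (cases "m q = i")
    case True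
    then have "R i = {q}" using block_single[OF R q(1)] by simp
    obtain w where w: "w \<in> L j" "w \<noteq> q" using block_mate[OF L q(2)] True ij by blast
    then have wB: "w \<in> R Blue" using L_cover[of j i Blue] \<open>R i = {q}\<close> ij by blast
    have "w \<noteq> r" using w ri L_disj[of i j] ij by blast
    have "m r \<noteq> i" using block_single[OF L ri] p \<open>p \<noteq> r\<close> by auto
    moreover have "m r \<noteq> Blue" using block_single[OF R r] wB \<open>w \<noteq> r\<close> by auto
    moreover have "m w \<noteq> j" using block_single[OF L w(1)] q w by auto
    moreover have "m w \<noteq> Blue" using block_single[OF R wB] r \<open>w \<noteq> r\<close> by auto
    ultimately have "m r = j" "m w = i" using ij by (metis colour.exhaust)+
    then show False
      using no_lone_blue_pivot[of i j p r w q] ij w(2) mp True \<open>p \<noteq> r\<close>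
        L_eq[OF p(2) ri] R_eq[OF r wB] L_eq[OF w(1) q(2)]
        in_V(1)[OF p(2)] in_V(1)[OF ri] in_V(1)[OF w(1)] in_V(1)[OF q(2)]
      by simp
  next
    case False
    then obtain q' where q': "q' \<in> R i" "q' \<noteq> q" using block_mate[OF R q(1)] by blast
    then have "q' \<in> L j" using Ri by blast
    have "L j = {q, q'}" using block_eq[OF L q(2) \<open>q' \<in> L j\<close>] q'(2) by blast
    moreover have "q \<notin> R Blue" "q' \<notin> R Blue" using q(1) q'(1) R_disj[OF ij(2)] by blast+
    ultimately have "R Blue \<inter> L j = {}" by auto
    then have "R Blue \<subseteq> L i" using R_cover[of Blue i j] ij by blast
    moreover have "L i = {p, r}" using block_eq[OF L p(2) ri \<open>p \<noteq> r\<close>] .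
    moreover have "p \<notin> R Blue" using p(1) R_disj[OF ij(3)] by blast
    ultimately have "R Blue = {r}" using r by auto
    then have "m r = Blue" using block_single_iff[OF R r] by simp
    then show False
      using no_pivot_and_double[of i j p r q q'] ij q'(2) mp
        L_eq[OF p(2) ri] R_eq[OF q(1) q'(1)] L_eq[OF q(2) \<open>q' \<in> L j\<close>]
        in_V(1)[OF p(2)] in_V(1)[OF ri] in_V(1)[OF q(2)] in_V(2)[OF q'(1)]
      by simp
  qed
qed

end

section \<open>Landmarks from cycle colourings\<close>

context cycle_colouring begin

text \<open>When one coordinate agrees, the other two could only exchange their blocks, which would
  give two disjoint double edges in the same two colours.\<close>

lemma eq_if_eq_at:
  assumes L: "\<And>i. block i (L i)" and R: "\<And>i. block i (R i)"
    and ne: "\<And>i. i \<noteq> Blue \<Longrightarrow> L i \<noteq> {}" "\<And>i. i \<noteq> Blue \<Longrightarrow> R i \<noteq> {}"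
    and ijk: "i \<noteq> j" "j \<noteq> k" "i \<noteq> k"
    and count: "\<And>v. (of_bool (v \<in> L j) + of_bool (v \<in> L k) :: nat) = of_bool (v \<in> R j) + of_bool (v \<in> R k)"
  shows "L j = R j"
proof (rule ccontr)
  assume neq: "L j \<noteq> R j"
  have "L k \<noteq> R k"
  proof
    assume "L k = R k"
    then have "v \<in> L j \<longleftrightarrow> v \<in> R j" for v using count[of v] by (simp add: of_bool_eq_iff)
    with neq show False by blast
  qed
  then have disj: "L j \<inter> R j = {}" "L k \<inter> R k = {}"
    using block_disjoint[OF L R] neq by blast+
  have "v \<in> L j \<longleftrightarrow> v \<in> R k" "v \<in> L k \<longleftrightarrow> v \<in> R j" for v
    using count[of v] disj by (auto simp: of_bool_def split: if_splits)
  then have eq: "R k = L j" "L k = R j" by blast+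
  have "j \<noteq> Blue \<or> k \<noteq> Blue" using ijk by auto
  then have "L j \<noteq> {}" "R j \<noteq> {}" using ne[of j] ne[of k] eq by auto
  then obtain d u where d: "d \<in> L j" and u: "u \<in> R j" by blast
  obtain d' where d': "d' \<in> L j" "d' \<noteq> d"
    using block_both[OF L[of j] _ ijk(2) d] R[of k] eq by auto
  obtain u' where u': "u' \<in> R j" "u' \<noteq> u"
    using block_both[OF R[of j] _ ijk(2) u] L[of k] eq by auto
  have Lk: "block k (R j)" and Rk: "block k (L j)" using L[of k] R[of k] eq by auto
  have "m u \<noteq> j" using block_single[OF R u] u' by auto
  moreover have "m u \<noteq> k" using block_single[OF Lk u] u' by auto
  ultimately have "m u = i" using ijk by (metis colour.exhaust)
  \<comment> \<open>\<open>double\<close> is applied to the degenerate path \<open>u\<close>,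
    \<open>u'\<close>, \<open>u\<close>, back and forth on the second double edge.\<close>
  then have "u' = d \<or> u' = d'"
    using double[of j k i d d' u u' u] ijk d'(2) u'(2)
      blockD[OF L d d'(1)] blockD[OF Rk d d'(1)] blockD[OF R u u'(1)] blockD[OF Lk u'(1) u]
      block_in_V[OF L d] block_in_V[OF L d'(1)] block_in_V[OF R u] block_in_V[OF R u'(1)]
    by simp
  then show False using d d' u' disj by blast
qed

text \<open>If the selections agree in one colour, \<open>eq_if_eq_at\<close> applies. Otherwise
  blocks of equal colour are disjoint and the selections form an \<open>ambiguity\<close> in either
  order.\<close>

lemma selection_unique:
  assumes L: "\<And>i. block i (L i)" and R: "\<And>i. block i (R i)"
    and ne: "\<And>i. i \<noteq> Blue \<Longrightarrow> L i \<noteq> {}" "\<And>i. i \<noteq> Blue \<Longrightarrow> R i \<noteq> {}"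
    and count: "\<And>v. (of_bool (v \<in> L Red) + of_bool (v \<in> L Green) + of_bool (v \<in> L Blue) :: nat)
      = of_bool (v \<in> R Red) + of_bool (v \<in> R Green) + of_bool (v \<in> R Blue)"
  shows "L i = R i"
proof -
  have count': "(of_bool (v \<in> L i) + of_bool (v \<in> L j) + of_bool (v \<in> L k) :: nat)
      = of_bool (v \<in> R i) + of_bool (v \<in> R j) + of_bool (v \<in> R k)"
    if "i \<noteq> j" "j \<noteq> k" "i \<noteq> k" for i j k v
    using count[of v] that by (cases i; cases j; cases k) (simp_all add: add_ac)
  show ?thesis
  proof (cases "\<exists>i. L i = R i")
    case True
    then obtain i0 where i0: "L i0 = R i0" by blast
    have "L j = R j" if "j \<noteq> i0" for j
    proof -
      obtain k where k: "j \<noteq> k" "i0 \<noteq> k" using that by (metis colour.distinct)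
      show ?thesis
      proof (rule eq_if_eq_at[OF L R ne that[symmetric] k])
        show "(of_bool (v \<in> L j) + of_bool (v \<in> L k) :: nat) = of_bool (v \<in> R j) + of_bool (v \<in> R k)" for v
          using count'[of i0 j k v] that k i0 by simp
      qed
    qed
    with i0 show ?thesis by (cases "i = i0") auto
  next
    case False
    have LR: "L i \<inter> R i = {}" for i using block_disjoint[OF L R] False by blast
    \<comment> \<open>A vertex of \<open>L i\<close> and \<open>L j\<close> could be counted on the
      right only once, in \<open>R k\<close>.\<close>
    have amb: "(v \<in> L i \<longrightarrow> v \<notin> L j \<and> (v \<in> R j \<or> v \<in> R k)) \<and> (v \<in> R i \<longrightarrow> v \<notin> R j \<and> (v \<in> L j \<or> v \<in> L k))"
      if "i \<noteq> j" "j \<noteq> k" "i \<noteq> k" for i j k v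
    proof -
      have "\<not> (v \<in> L i \<and> v \<in> R i)" "\<not> (v \<in> L j \<and> v \<in> R j)" "\<not> (v \<in> L k \<and> v \<in> R k)"
        using LR by blast+
      then show ?thesis
        using count'[OF that, of v] by (simp add: of_bool_def split: if_splits)
    qed
    have third: "\<exists>k. j \<noteq> k \<and> i \<noteq> k" for i j :: colour by (metis colour.distinct)
    have disj: "L i \<inter> L j = {}" "R i \<inter> R j = {}" if "i \<noteq> j" for i j
      using amb that third[of j i] by blast+
    have cover: "L i \<subseteq> R j \<union> R k" "R i \<subseteq> L j \<union> L k" if "i \<noteq> j" "j \<noteq> k" "i \<noteq> k" for i j k
      using amb[OF that] by blast+
    interpret LR: ambiguity V f m L R
      using L R LR disj cover by unfold_locales
    interpret RL: ambiguity V f m R L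
      using L R LR[unfolded Int_commute[of "L _"]] disj cover by unfold_locales
    have iff: "(\<forall>i. X i \<noteq> {}) \<longleftrightarrow> X Blue \<noteq> {}" if "\<And>i. i \<noteq> Blue \<Longrightarrow> X i \<noteq> {}" for X :: "colour \<Rightarrow> 'v set"
      using that by metis
    \<comment> \<open>At most one blue block is empty, since two empty ones would be equal.\<close>
    have "L Blue = {} \<and> R Blue \<noteq> {} \<or> L Blue \<noteq> {} \<and> R Blue = {} \<or> L Blue \<noteq> {} \<and> R Blue \<noteq> {}"
      using False by metis
    then show ?thesis
      using LR.no_ambiguity_blue_empty RL.no_ambiguity_blue_empty LR.no_nonempty_ambiguity
        iff[of L, OF ne(1)] iff[of R, OF ne(2)] ne by metis
  qed
qed

end

lemma number_labels:
  assumes "finite V"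
  shows "\<exists>n. n ` V = {1..card (g ` V)} \<and> (\<forall>u\<in>V. \<forall>v\<in>V. n u = n v \<longleftrightarrow> g u = g v)"
proof -
  obtain h where h: "bij_betw h (g ` V) {1..card (g ` V)}"
    using ex_bij_betw_finite_nat[of "g ` V"] assms finite_same_card_bij[of "g ` V" "{1..card (g ` V)}"]
    by auto
  have "(h \<circ> g) ` V = {1..card (g ` V)}"
    using h by (simp add: bij_betw_def image_comp)
  moreover have "h (g u) = h (g v) \<longleftrightarrow> g u = g v" if "u \<in> V" "v \<in> V" for u v
    using h that by (auto simp: bij_betw_def inj_on_def)
  ultimately show ?thesis by (intro exI[of _ "h \<circ> g"]) auto
qed

context cycle_colouring begin

text \<open>Each vertex becomes the landmark whose coordinates are its three labels; a triple agrees
  with it in as many coordinates as selected blocks contain the vertex.\<close>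

lemma landmarks_exist:
  assumes fin: "finite V"
  shows "\<exists>U \<subseteq> {1..card (f Red ` V)} \<times> {1..card (f Green ` V)} \<times> {1..card (f Blue ` V)}.
    landmarks (card (f Red ` V)) (card (f Green ` V)) (card (f Blue ` V) + 1) U \<and> card U \<le> card V"
proof -
  have "\<forall>i. \<exists>n. n ` V = {1..card (f i ` V)} \<and> (\<forall>u\<in>V. \<forall>v\<in>V. n u = n v \<longleftrightarrow> f i u = f i v)"
    using number_labels[OF fin] by blast
  then obtain n where n: "\<And>i. n i ` V = {1..card (f i ` V)}"
    and n_eq: "\<And>i u v. u \<in> V \<Longrightarrow> v \<in> V \<Longrightarrow> n i u = n i v \<longleftrightarrow> f i u = f i v"
    by metis
  define U where "U = (\<lambda>v. (n Red v, n Green v, n Blue v)) ` V"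
  have sub: "U \<subseteq> {1..card (f Red ` V)} \<times> {1..card (f Green ` V)} \<times> {1..card (f Blue ` V)}"
    unfolding U_def n[symmetric] by blast
  have "landmarks (card (f Red ` V)) (card (f Green ` V)) (card (f Blue ` V) + 1) U"
    unfolding landmarks_def
  proof (intro ballI impI)
    fix s t
    assume s: "s \<in> {1..card (f Red ` V)} \<times> {1..card (f Green ` V)} \<times> {1..card (f Blue ` V) + 1}"
      and t: "t \<in> {1..card (f Red ` V)} \<times> {1..card (f Green ` V)} \<times> {1..card (f Blue ` V) + 1}"
      and agree: "\<forall>q\<in>U. agree s q = agree t q"
    define coord :: "nat \<times> nat \<times> nat \<Rightarrow> colour \<Rightarrow> nat" where
      "coord p i = (case i of Red \<Rightarrow> fst p | Green \<Rightarrow> fst (snd p) | Blue \<Rightarrow> snd (snd p))" for p i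
    define B where "B p i = {v \<in> V. n i v = coord p i}" for p i
    have range: "coord s i \<in> n i ` V" "coord t i \<in> n i ` V" if "i \<noteq> Blue" for i
      using s t that unfolding n by (cases i; auto simp: coord_def)+
    have blk: "block i (B p i)" for p i
      unfolding block_def B_def by (auto simp: n_eq[symmetric])
    have ne: "B s i \<noteq> {}" "B t i \<noteq> {}" if "i \<noteq> Blue" for i
      using range[OF that] unfolding B_def by auto
    have eq: "B s i = B t i" for i
    proof (rule selection_unique)
      show "(of_bool (v \<in> B s Red) + of_bool (v \<in> B s Green) + of_bool (v \<in> B s Blue) :: nat)
        = of_bool (v \<in> B t Red) + of_bool (v \<in> B t Green) + of_bool (v \<in> B t Blue)" for v
      proof (cases "v \<in> V")
        case True
        then have "agree s (n Red v, n Green v, n Blue v) = agree t (n Red v, n Green v, n Blue v)"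
          using agree unfolding U_def by blast
        then show ?thesis using True by (simp add: agree_def B_def coord_def eq_commute)
      qed (simp add: B_def)
    qed (use blk ne in auto)
    have coord_eq: "coord s i = coord t i" if c: "coord s i \<in> n i ` V \<or> coord t i \<in> n i ` V" for i
    proof -
      obtain v where "v \<in> B s i \<or> v \<in> B t i" using c unfolding B_def by force
      then have "v \<in> B s i" "v \<in> B t i" using eq[of i] by auto
      then show ?thesis unfolding B_def by simp
    qed
    \<comment> \<open>Only one admissible blue value is borne by no vertex, so two triples with
      empty blue blocks coincide there.\<close>
    have "coord s Blue = coord t Blue"
    proof (cases "coord s Blue \<in> n Blue ` V \<or> coord t Blue \<in> n Blue ` V")
      case False
      then show ?thesis using s t unfolding n by (auto simp: coord_def)
    qed (rule coord_eq)
    moreover have "coord s Red = coord t Red" "coord s Green = coord t Green"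
      using coord_eq range by blast+
    ultimately show "s = t" by (simp add: coord_def prod_eq_iff)
  qed
  moreover have "card U \<le> card V" unfolding U_def by (rule card_image_le[OF fin])
  ultimately show ?thesis using sub by blast
qed

end

section \<open>Cycles\<close>

lemma three_colours:
  fixes i j k l :: colour
  assumes "i \<noteq> j" "j \<noteq> k" "i \<noteq> k"
  shows "l = i \<or> l = j \<or> l = k"
  using assms
  by (cases i; cases j; cases k; cases l) simp_all

lemma UNIV_colour: "UNIV = {Red, Green, Blue}"
  using colour.exhaust by auto

text \<open>On the cycle whose vertices all miss \<open>k\<close>, this selects which remaining
  colour gets the edges \<open>{2 h, 2 h + 1}\<close>; the other one gets those of
  \<open>pairing\<close>.\<close>

fun succ_colour :: "colour \<Rightarrow> colour" where
  "succ_colour Red = Green"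
| "succ_colour Green = Blue"
| "succ_colour Blue = Red"

text \<open>On a cycle \<open>0, \<dots>, 2 p - 1\<close> the edges \<open>{2 h, 2 h + 1}\<close> are the fibres of \<open>\<lambda>n. n div 2\<close>,
  and the other edges are those of \<open>pairing p\<close>.\<close>
definition pairing :: "nat \<Rightarrow> nat \<Rightarrow> nat" where
  "pairing p n = (if n + 1 = 2 * p then 0 else n + 1) div 2"

text \<open>Two of three numbers have equal parity, and parity and half determine a number.\<close>

lemma div_2_le_2:
  assumes "n div 2 = n' div 2" "n'' div 2 = n' div (2::nat)"
  shows "n = n' \<or> n = n'' \<or> n' = n''"
proof -
  have "n mod 2 = n' mod 2 \<or> n mod 2 = n'' mod 2 \<or> n' mod 2 = n'' mod 2"
    unfolding mod_2_eq_odd by auto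
  then show ?thesis using assms by (metis div_mult_mod_eq)
qed

lemma pairing_le_2:
  assumes "n < 2 * p" "n' < 2 * p" "n'' < 2 * p" "pairing p n = pairing p n'" "pairing p n'' = pairing p n'"
  shows "n = n' \<or> n = n'' \<or> n' = n''"
  using div_2_le_2[OF assms(4,5)[unfolded pairing_def]] by (auto split: if_splits)

lemma pairing_mate:
  assumes "n < 2 * p"
  shows "\<exists>n'<2 * p. n' \<noteq> n \<and> pairing p n' = pairing p n"
proof -
  consider "n = 0" | "even n" "n \<noteq> 0" | "odd n" "n + 1 = 2 * p" | "odd n" "n + 1 < 2 * p"
    using assms by linarith
  then show ?thesis
  proof cases
    case 1
    then show ?thesis using assms by (intro exI[of _ "2 * p - 1"]) (auto simp: pairing_def)
  next
    case 2
    then obtain b where "n = 2 * b" "b \<noteq> 0" by auto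
    moreover have "2 * b + 1 \<noteq> 2 * p" by presburger
    ultimately show ?thesis using assms by (intro exI[of _ "n - 1"]) (auto simp: pairing_def)
  next
    case 3
    then show ?thesis using assms by (intro exI[of _ 0]) (auto simp: pairing_def odd_pos)
  next
    case 4
    then obtain b where "n = 2 * b + 1" by (auto elim: oddE)
    moreover have "Suc (Suc (Suc (2 * b))) \<noteq> 2 * p" by presburger
    ultimately show ?thesis using 4 by (intro exI[of _ "n + 1"]) (auto simp: pairing_def)
  qed
qed

lemma div_2_mate:
  assumes "(n::nat) < 2 * p"
  shows "\<exists>n'<2 * p. n' \<noteq> n \<and> n' div 2 = n div 2"
proof (cases "even n")
  case True
  then show ?thesis using assms by (intro exI[of _ "n + 1"]) (auto elim!: evenE)
next
  case False
  then show ?thesis using assms by (intro exI[of _ "n - 1"]) (auto elim!: oddE)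
qed

text \<open>At \<open>2 h\<close> and \<open>2 h + 1\<close>, \<open>pairing\<close> takes the
  values \<open>h\<close> and \<open>h + 1\<close>, or \<open>h\<close> and 0 at the wrap-around;
  these agree only for \<open>h = 0\<close> and \<open>p = 1\<close>.\<close>

lemma pairing_double:
  assumes "n < 2 * p" "n' < 2 * p" "n div 2 = n' div 2" "pairing p n = pairing p n'" "n \<noteq> n'"
  shows "p = 1"
proof -
  define h where "h = n div 2"
  have "p = 1" if "2 * h + 1 < 2 * p" "pairing p (2 * h) = pairing p (2 * h + 1)"
    using that by (auto simp: pairing_def split: if_splits)
  moreover have "n = 2 * h \<and> n' = 2 * h + 1 \<or> n' = 2 * h \<and> n = 2 * h + 1"
  proof -
    have "n = 2 * h + n mod 2" "n' = 2 * h + n' mod 2" 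
      using assms(3) mult_div_mod_eq[of 2 n] mult_div_mod_eq[of 2 n'] unfolding h_def by linarith+
    with assms(5) show ?thesis unfolding mod_2_eq_odd by (cases "even n"; cases "even n'") auto
  qed
  ultimately show ?thesis using assms(1,2,4) by auto
qed

lemma image_lessThan_eqI:
  assumes "\<And>n. n < N \<Longrightarrow> g n < M" "\<And>m. m < M \<Longrightarrow> \<exists>n<N. g n = (m::nat)"
  shows "g ` {..<N::nat} = {..<M}"
  using assms by fastforce

lemma card_image_pairing: "card (pairing p ` {..<2 * p}) = p"
proof -
  have "pairing p ` {..<2 * p} = {..<p}"
  proof (rule image_lessThan_eqI)
    show "\<exists>n<2 * p. pairing p n = m" if "m < p" for m
      using that by (intro exI[of _ "2 * m"]) (auto simp: pairing_def)
  qed (auto simp: pairing_def)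
  then show ?thesis by simp
qed

lemma card_image_div_2: "card ((\<lambda>n. n div 2) ` {..<2 * p}) = (p::nat)"
proof -
  have "(\<lambda>n. n div 2) ` {..<2 * p} = {..<p}"
  proof (rule image_lessThan_eqI)
    show "\<exists>n<2 * p. n div 2 = m" if "m < p" for m
      using that by (intro exI[of _ "2 * m"]) auto
  qed auto
  then show ?thesis by simp
qed

section \<open>Disjoint unions of two-coloured even cycles\<close>

definition component_label :: "(colour \<Rightarrow> nat) \<Rightarrow> colour \<Rightarrow> colour \<Rightarrow> nat \<Rightarrow> nat" where
  "component_label p i k n =
    (if i = k then n else if i = succ_colour k then n div 2 else pairing (p k) n)"

lemma component_mate:
  assumes "n < 2 * p k" "i \<noteq> k"
  shows "\<exists>n'<2 * p k. n' \<noteq> n \<and> component_label p i k n' = component_label p i k n"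
  using pairing_mate[OF assms(1)] div_2_mate[OF assms(1)] assms(2) by (simp add: component_label_def)

lemma component_le_2:
  assumes "n < 2 * p k" "n' < 2 * p k" "n'' < 2 * p k"
    "component_label p i k n = component_label p i k n'" "component_label p i k n'' = component_label p i k n'"
  shows "n = n' \<or> n = n'' \<or> n' = n''"
  using pairing_le_2[OF assms(1-3)] div_2_le_2[of n n' n''] assms(4,5)
  by (auto simp: component_label_def split: if_splits)

lemma component_double:
  assumes "n < 2 * p k" "n' < 2 * p k" "n \<noteq> n'" "i \<noteq> j"
    "component_label p i k n = component_label p i k n'" "component_label p j k n = component_label p j k n'"
  shows "i \<noteq> k" "j \<noteq> k" "p k = 1"
proof -
  show ik: "i \<noteq> k" and jk: "j \<noteq> k" using assms by (auto simp: component_label_def)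
  then have "i = succ_colour k \<or> j = succ_colour k"
    using assms(4) by (cases i; cases j; cases k) simp_all
  then have "n div 2 = n' div 2" "pairing (p k) n = pairing (p k) n'"
    using assms(4-6) ik jk by (auto simp: component_label_def split: if_splits)
  then show "p k = 1" using pairing_double assms(1-3) by blast
qed

lemma card_image_component_label:
  "card (component_label p i k ` {..<2 * p k}) = (if i = k then 2 * p k else p k)"
  using card_image_pairing[of "p k"] card_image_div_2[of "p k"]
  by (simp add: component_label_def[abs_def])

lemma card_image_components:
  fixes N :: "colour \<Rightarrow> nat"
  shows "card ((\<lambda>(k, n). (k, h k n)) ` (SIGMA k:UNIV. {..<N k})) =
    card (h Red ` {..<N Red}) + card (h Green ` {..<N Green}) + card (h Blue ` {..<N Blue})"
proof -
  have "(\<lambda>(k, n). (k, h k n)) ` (SIGMA k:UNIV. {..<N k}) = (SIGMA k:UNIV. h k ` {..<N k})"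
    by force
  then show ?thesis by (simp add: UNIV_colour card_SigmaI)
qed

lemma card_components:
  fixes N :: "colour \<Rightarrow> nat"
  shows "card (SIGMA k:UNIV. {..<N k}) = N Red + N Green + N Blue"
  by (simp add: UNIV_colour card_SigmaI)

lemma finite_components: "finite (SIGMA k:(UNIV::colour set). {..<N k::nat})"
  by (simp add: UNIV_colour)

text \<open>The missing colour is constant on components, so there are no pivots. Double edges occur
  only as whole components of length 2, and having all three kinds would need \<open>p k = 1\<close>
  for every \<open>k\<close>.\<close>

lemma even_cycle_colouring:
  assumes "p k0 \<noteq> 1"
  shows "cycle_colouring (SIGMA k:UNIV. {..<2 * p k}) (\<lambda>i (k, n). (k, component_label p i k n)) fst"
    (is "cycle_colouring ?V ?f fst")
proof -
  have comp: "fst u = fst v" if "?f i u = ?f i v" for i u v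
    using that by (auto split: prod.splits)
  have dbl: "fst d \<noteq> i \<and> fst d \<noteq> j \<and> p (fst d) = 1"
    if d: "d \<in> ?V" "d' \<in> ?V" "d \<noteq> d'" "?f i d = ?f i d'" "?f j d = ?f j d'" "i \<noteq> j" for i j d d'
  proof -
    obtain k n n' where "d = (k, n)" "d' = (k, n')"
      using comp[OF d(4)] by (metis prod.collapse)
    then show ?thesis using component_double[of n p k n' i j] d by auto
  qed
  show ?thesis
  proof (unfold_locales, goal_cases)
    case (1 u v)
    then show ?case by (auto simp: component_label_def split: prod.splits)
  next
    case (2 v i)
    obtain k n where v: "v = (k, n)" by fastforce
    then obtain n' where "n' < 2 * p k" "n' \<noteq> n" "component_label p i k n' = component_label p i k n"
      using component_mate[of n p k i] 2 by auto
    then show ?case using v by (intro bexI[of _ "(k, n')"]) auto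
  next
    case (3 u v w i)
    obtain k n n' n'' where "u = (k, n)" "v = (k, n')" "w = (k, n'')"
      using comp[OF 3(4)] comp[OF 3(5)] by (metis prod.collapse)
    then show ?case using component_le_2[of n p k n' n'' i] 3 by auto
  next
    case (4 i j k u v u' v')
    then show ?case using comp[of i u v] by simp
  next
    case (5 i j k d d' u v w)
    have "fst d = k" "p k = 1"
      using dbl[OF 5(4-8,1)] three_colours[OF 5(1-3), of "fst d"] by auto
    moreover have "fst d' = k" "fst v = k"
      using calculation comp[OF 5(7)] comp[OF 5(14)] 5(16) by simp_all
    ultimately show ?case using 5(4,5,6,10) by (auto simp: less_2_cases_iff)
  next
    case (6 i j k d1 d1' d2 d2' d3 d3')
    have "p (fst d1) = 1" "p (fst d2) = 1" "p (fst d3) = 1" "fst d1 = k" "fst d2 = i" "fst d3 = j"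
      using dbl[OF 6(4-8,1)] dbl[OF 6(9-13,2)] dbl[OF 6(14-18) 6(3)[symmetric]]
        three_colours[OF 6(1-3), of "fst d1"] three_colours[OF 6(1-3), of "fst d2"]
        three_colours[OF 6(1-3), of "fst d3"] by auto
    then have "p k0 = 1" using three_colours[OF 6(1-3), of k0] by auto
    then show ?case using assms by simp
  next
    case (7 i j k u1 u2 u3 u4 u5)
    then show ?case using comp[of j u2 u3] by simp
  next
    case (8 i j u1 u2 u3 u4)
    then show ?case using comp[of Blue u2 u3] by simp
  next
    case (9 i j u v d d')
    then show ?case using comp[of i u v] by simp
  qed
qed

text \<open>Vertices \<open>0, \<dots>, 2 x + 2\<close> in cyclic order; the blue edge joins the first and the last one.\<close>
definition odd_label :: "nat \<Rightarrow> colour \<Rightarrow> nat \<Rightarrow> nat" where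
  "odd_label x i n = (case i of Red \<Rightarrow> n div 2 | Green \<Rightarrow> (n + 1) div 2 |
    Blue \<Rightarrow> if n = 2 * x + 2 then 0 else n)"

definition odd_missing :: "nat \<Rightarrow> nat \<Rightarrow> colour" where
  "odd_missing x n = (if n = 0 then Green else if n = 2 * x + 2 then Red else Blue)"

lemma odd_single:
  assumes "n < 2 * x + 3" "n' < 2 * x + 3"
    "odd_label x (odd_missing x n') n = odd_label x (odd_missing x n') n'"
  shows "n = n'"
  using assms by (auto simp: odd_label_def odd_missing_def split: if_splits)

lemma odd_mate:
  assumes "n < 2 * x + 3" "i \<noteq> odd_missing x n"
  shows "\<exists>n'<2 * x + 3. n' \<noteq> n \<and> odd_label x i n' = odd_label x i n"
proof (cases i)
  case Red
  then have "n \<noteq> 2 * x + 2" using assms(2) by (auto simp: odd_missing_def)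
  then have "n < 2 * (x + 1)" using assms(1) by simp
  from div_2_mate[OF this] obtain n' where "n' < 2 * (x + 1)" "n' \<noteq> n" "n' div 2 = n div 2"
    by blast
  then show ?thesis using Red by (intro exI[of _ n']) (simp add: odd_label_def)
next
  case Green
  then have "n \<noteq> 0" using assms(2) by (auto simp: odd_missing_def split: if_splits)
  then have "n - 1 < 2 * (x + 1)" using assms(1) by simp
  from div_2_mate[OF this] obtain n'
    where n': "n' < 2 * (x + 1)" "n' \<noteq> n - 1" "n' div 2 = (n - 1) div 2"
    by blast
  then have "(n' + 2) div 2 = (n + 1) div 2" using \<open>n \<noteq> 0\<close> by (cases n) simp_all
  then show ?thesis using Green n' by (intro exI[of _ "n' + 1"]) (auto simp: odd_label_def)
next
  case Blue
  then consider "n = 0" | "n = 2 * x + 2"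
    using assms(2) by (auto simp: odd_missing_def split: if_splits)
  then show ?thesis
  proof cases
    case 1
    then show ?thesis using Blue by (intro exI[of _ "2 * x + 2"]) (simp add: odd_label_def)
  next
    case 2
    then show ?thesis using Blue by (intro exI[of _ 0]) (simp add: odd_label_def)
  qed
qed

lemma odd_le_2:
  assumes "odd_label x i n = odd_label x i n'" "odd_label x i n'' = odd_label x i n'"
  shows "n = n' \<or> n = n'' \<or> n' = n''"
  using assms div_2_le_2[of n n' n''] div_2_le_2[of "n + 1" "n' + 1" "n'' + 1"]
  by (cases i) (auto simp: odd_label_def split: if_splits)

lemma odd_no_double:
  assumes "n < 2 * x + 3" "n' < 2 * x + 3" "i \<noteq> j"
    "odd_label x i n = odd_label x i n'" "odd_label x j n = odd_label x j n'"
  shows "n = n'"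
proof -
  have "n = n'" if "odd_label x Red n = odd_label x Red n'" "odd_label x Green n = odd_label x Green n'"
  proof -
    \<comment> \<open>The red and green labels add up to the vertex itself.\<close>
    have "l div 2 + (l + 1) div 2 = l" for l :: nat by presburger
    then show ?thesis using that unfolding odd_label_def colour.case by metis
  qed
  moreover have "n = n'" if "odd_label x Red n = odd_label x Red n'" "odd_label x Blue n = odd_label x Blue n'"
    using that by (auto simp: odd_label_def split: if_splits)
  moreover have "n = n'" if "odd_label x Green n = odd_label x Green n'" "odd_label x Blue n = odd_label x Blue n'"
    using that by (auto simp: odd_label_def split: if_splits)
  ultimately show ?thesis using assms(3-5) by (cases i; cases j) blast+
qed

text \<open>The only pivots are the red edge \<open>{0, 1}\<close>, the green edge
  \<open>{2 x + 1, 2 x + 2}\<close> and the blue edge, one per colour.\<close>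

lemma odd_pivot:
  assumes "n < 2 * x + 3" "n' < 2 * x + 3" "i \<noteq> j" "j \<noteq> k" "i \<noteq> k"
    "odd_label x i n = odd_label x i n'" "odd_missing x n = j" "odd_missing x n' = k"
  shows "n = (if j = Green then 0 else if j = Red then 2 * x + 2 else if i = Red then 1 else 2 * x + 1)"
proof (cases j)
  case Blue
  then consider "i = Red" "n' = 0" | "i = Green" "n' = 2 * x + 2"
    using assms(3-5,8) by (cases i) (auto simp: odd_missing_def split: if_splits)
  then show ?thesis
    using assms(1,6,7) Blue by cases (auto simp: odd_label_def odd_missing_def split: if_splits)
qed (use assms(7) in \<open>auto simp: odd_missing_def split: if_splits\<close>)

lemma odd_missing_inj: "odd_missing x n = odd_missing x n' \<Longrightarrow> odd_missing x n \<noteq> Blue \<Longrightarrow> n = n'"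
  by (auto simp: odd_missing_def split: if_splits)

lemma card_image_odd_label:
  "card (odd_label x Red ` {..<2 * x + 3}) = x + 2"
  "card (odd_label x Green ` {..<2 * x + 3}) = x + 2"
  "card (odd_label x Blue ` {..<2 * x + 3}) = 2 * x + 2"
proof -
  have "odd_label x Red ` {..<2 * x + 3} = {..<x + 2}"
  proof (rule image_lessThan_eqI)
    show "\<exists>n<2 * x + 3. odd_label x Red n = m" if "m < x + 2" for m
      using that by (intro exI[of _ "2 * m"]) (auto simp: odd_label_def)
  qed (auto simp: odd_label_def)
  then show "card (odd_label x Red ` {..<2 * x + 3}) = x + 2" by simp
  have "odd_label x Green ` {..<2 * x + 3} = {..<x + 2}"
  proof (rule image_lessThan_eqI)
    show "\<exists>n<2 * x + 3. odd_label x Green n = m" if "m < x + 2" for m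
      using that by (intro exI[of _ "2 * m"]) (auto simp: odd_label_def)
  qed (auto simp: odd_label_def)
  then show "card (odd_label x Green ` {..<2 * x + 3}) = x + 2" by simp
  have "odd_label x Blue ` {..<2 * x + 3} = {..<2 * x + 2}"
  proof (rule image_lessThan_eqI)
    show "\<exists>n<2 * x + 3. odd_label x Blue n = m" if "m < 2 * x + 2" for m
      using that by (intro exI[of _ m]) (auto simp: odd_label_def)
  qed (auto simp: odd_label_def)
  then show "card (odd_label x Blue ` {..<2 * x + 3}) = 2 * x + 2" by simp
qed

text \<open>Pivots live only on the odd cycle and double edges only off it, so red and green share
  no double edge. On the odd cycle red and green are each missing just once, which excludes the
  configurations with two such vertices.\<close>

lemma odd_cycle_colouring:
  "cycle_colouring (SIGMA k:UNIV. {..<if k = Blue then 2 * x + 3 else 2 * p k})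
    (\<lambda>i (k, n). (k, if k = Blue then odd_label x i n else component_label p i k n))
    (\<lambda>(k, n). if k = Blue then odd_missing x n else k)"
  (is "cycle_colouring ?V ?f ?m")
proof -
  have comp: "fst u = fst v" if "?f i u = ?f i v" for i u v
    using that by (auto split: prod.splits)
  have inj: "u = v" if "?m u = ?m v" "?m u \<noteq> Blue" "fst u = Blue" "fst v = Blue" for u v
    using that odd_missing_inj[of x "snd u" "snd v"] by (auto simp: prod_eq_iff split: prod.splits)
  have dbl: "fst d \<noteq> i \<and> fst d \<noteq> j \<and> p (fst d) = 1 \<and> fst d \<noteq> Blue"
    if d: "d \<in> ?V" "d' \<in> ?V" "d \<noteq> d'" "?f i d = ?f i d'" "?f j d = ?f j d'" "i \<noteq> j" for i j d d'
  proof -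
    obtain k n n' where "d = (k, n)" "d' = (k, n')"
      using comp[OF d(4)] by (metis prod.collapse)
    then show ?thesis
      using component_double[of n p k n' i j] odd_no_double[of n x n' i j] d by (auto split: if_splits)
  qed
  have pivot: "fst u = Blue \<and>
      snd u = (if j = Green then 0 else if j = Red then 2 * x + 2 else if i = Red then 1 else 2 * x + 1)"
    if u: "u \<in> ?V" "v \<in> ?V" "?f i u = ?f i v" "?m u = j" "?m v = k" "i \<noteq> j" "j \<noteq> k" "i \<noteq> k" for i j k u v
  proof -
    obtain l n n' where l: "u = (l, n)" "v = (l, n')"
      using comp[OF u(3)] by (metis prod.collapse)
    moreover have "l = Blue" using u(4,5,7) l by (auto split: if_splits)
    ultimately show ?thesis using odd_pivot[of n x n' i j k] u by simp
  qed
  show ?thesis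
  proof (unfold_locales, goal_cases)
    case (1 u v)
    then show ?case
      using odd_single[of "snd u" x "snd v"]
      by (auto simp: component_label_def split: prod.splits if_splits)
  next
    case (2 v i)
    obtain k n where v: "v = (k, n)" by fastforce
    show ?case
    proof (cases "k = Blue")
      case True
      then obtain n' where "n' < 2 * x + 3" "n' \<noteq> n" "odd_label x i n' = odd_label x i n"
        using odd_mate[of n x i] 2 v by auto
      then show ?thesis using v True by (intro bexI[of _ "(k, n')"]) auto
    next
      case False
      then obtain n' where "n' < 2 * p k" "n' \<noteq> n" "component_label p i k n' = component_label p i k n"
        using component_mate[of n p k i] 2 v by auto
      then show ?thesis using v False by (intro bexI[of _ "(k, n')"]) auto
    qed
  next
    case (3 u v w i)
    obtain k n n' n'' where "u = (k, n)" "v = (k, n')" "w = (k, n'')"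
      using comp[OF 3(4)] comp[OF 3(5)] by (metis prod.collapse)
    then show ?case
      using component_le_2[of n p k n' n'' i] odd_le_2[of x i n n' n''] 3 by (auto split: if_splits)
  next
    case (4 i j k u v u' v')
    have "fst u = Blue \<and> snd u = snd u' \<and> fst u' = Blue"
      using pivot[OF 4(4,5,8-10,1-3)] pivot[OF 4(6,7,11-13,1-3)] by simp
    then show ?case by (simp add: prod_eq_iff)
  next
    case (5 i j k d d' u v w)
    have d: "fst d = k" "p k = 1" "k \<noteq> Blue"
      using dbl[OF 5(4-8,1)] three_colours[OF 5(1-3), of "fst d"] by auto
    have eq: "fst u = fst v" "fst v = fst w" "fst d' = fst d"
      using comp[OF 5(14)] comp[OF 5(15)] comp[OF 5(7)] by simp_all
    \<comment> \<open>On the odd cycle \<open>u\<close> and \<open>w\<close> would coincide, making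
      \<open>u\<close>, \<open>v\<close> a double edge there.\<close>
    have "fst u \<noteq> Blue"
    proof
      assume "fst u = Blue"
      then have "u = w" using inj[of u w] eq 5(16,17) d by simp
      then have "?f j u = ?f j v" using 5(15) by simp
      from dbl[OF 5(9,10,12,14) this 5(1)] \<open>fst u = Blue\<close> show False by simp
    qed
    then have "fst u = k" using 5(16) by (auto split: prod.splits)
    with eq d show ?case using 5(4,5,6,10) by (auto simp: less_2_cases_iff)
  next
    case (6 i j k d1 d1' d2 d2' d3 d3')
    have "fst d1 = k \<and> fst d1 \<noteq> Blue" "fst d2 = i \<and> fst d2 \<noteq> Blue" "fst d3 = j \<and> fst d3 \<noteq> Blue"
      using dbl[OF 6(4-8,1)] dbl[OF 6(9-13,2)] dbl[OF 6(14-18) 6(3)[symmetric]]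
        three_colours[OF 6(1-3), of "fst d1"] three_colours[OF 6(1-3), of "fst d2"]
        three_colours[OF 6(1-3), of "fst d3"] by auto
    then show ?case using three_colours[OF 6(1-3), of Blue] by auto
  next
    case (7 i j k u1 u2 u3 u4 u5)
    have "fst u2 = Blue" using pivot[OF 7(5,6,12,16,17)] 7(1-3) by simp
    moreover have "fst u4 = Blue" using pivot[OF 7(7,6) 7(13)[symmetric] 7(18,17)] 7(1-3) by simp
    ultimately have "i = Blue" "j = Blue"
      using inj[of u1 u2] inj[of u4 u5] comp[OF 7(11)] comp[OF 7(14)] 7(9,10,15,16,18,19) by auto
    then show ?case using 7(1) by simp
  next
    case (8 i j u1 u2 u3 u4)
    have "fst u2 = Blue" using pivot[OF 8(5,6,11,14,15)] 8(1-3) by simp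
    then show ?case
      using inj[of u1 u2] comp[OF 8(10)] 8(3,8,13,14) by auto
  next
    case (9 i j u v d d')
    have "fst d = Blue \<or> fst d = i \<or> fst d = j" using three_colours[OF 9(1,3,2), of "fst d"] by auto
    then show ?case using dbl[OF 9(9-13) 9(1)] by blast
  qed
qed

section \<open>Choice of the cycle lengths\<close>

lemma even_landmarks:
  fixes x y z :: nat
  assumes "\<not> (x = 1 \<and> y = 1 \<and> z = 1)"
  defines "a \<equiv> 2 * y + z + x" and "b \<equiv> y + 2 * z + x" and "c \<equiv> y + z + 2 * x"
  shows "\<exists>U \<subseteq> {1..a} \<times> {1..b} \<times> {1..c}. landmarks a b (c + 1) U \<and> card U \<le> 2 * y + 2 * z + 2 * x"
proof -
  define p where "p k = (case k of Blue \<Rightarrow> x | Red \<Rightarrow> y | Green \<Rightarrow> z)" for k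
  have p: "p Blue = x" "p Red = y" "p Green = z" by (simp_all add: p_def)
  obtain k0 where "p k0 \<noteq> 1" using assms(1) p by metis
  then interpret cycle_colouring "SIGMA k:UNIV. {..<2 * p k}"
      "\<lambda>i (k, n). (k, component_label p i k n)" fst
    by (rule even_cycle_colouring)
  from landmarks_exist[OF finite_components] show ?thesis
    unfolding card_image_components card_components card_image_component_label
    by (simp add: p a_def b_def c_def)
qed

lemma odd_landmarks:
  fixes x y z :: nat
  defines "a \<equiv> 2 * y + z + (x + 2)" and "b \<equiv> y + 2 * z + (x + 2)"
    and "c \<equiv> y + z + (2 * x + 2)"
  shows "\<exists>U \<subseteq> {1..a} \<times> {1..b} \<times> {1..c}. landmarks a b (c + 1) U \<and> card U \<le> 2 * y + 2 * z + (2 * x + 3)"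
proof -
  define p where "p k = (if k = Red then y else z)" for k
  have p: "p Red = y" "p Green = z" by (simp_all add: p_def)
  interpret cycle_colouring "SIGMA k:UNIV. {..<if k = Blue then 2 * x + 3 else 2 * p k}"
    "\<lambda>i (k, n). (k, if k = Blue then odd_label x i n else component_label p i k n)"
    "\<lambda>(k, n). if k = Blue then odd_missing x n else k"
    by (rule odd_cycle_colouring)
  have "card (component_label p i Red ` {..<2 * y}) = (if i = Red then 2 * y else y)"
    "card (component_label p i Green ` {..<2 * z}) = (if i = Green then 2 * z else z)" for i
    using card_image_component_label[of p i Red] card_image_component_label[of p i Green] by (simp_all add: p)
  with landmarks_exist[OF finite_components] show ?thesis
    unfolding card_image_components card_components
    by (simp add: p a_def b_def c_def card_image_odd_label)
qed

lemma triangle_landmarks: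
  fixes a b c k :: nat
  assumes "a + b + c = 2 * k" "k \<le> 2 * a" "k \<le> 2 * b" "k \<le> 2 * c"
  shows "\<exists>U \<subseteq> {1..a} \<times> {1..b} \<times> {1..c}. landmarks a b (c + 1) U \<and> card U \<le> k"
proof (cases "even k")
  case True
  then obtain h where h: "k = 2 * h" by blast
  \<comment> \<open>The system has \<open>x + y + z = h\<close>, hence \<open>a = h + y\<close> and
    likewise for \<open>b\<close>, \<open>c\<close>; \<open>k \<le> 2 * a\<close> says
    \<open>h \<le> a\<close>.\<close>
  define x y z where "x = c - h" and "y = a - h" and "z = b - h"
  then have abc: "a = 2 * y + z + x" "b = y + 2 * z + x" "c = y + z + 2 * x"
      "k = 2 * y + 2 * z + 2 * x"
    using assms h by auto
  show ?thesis
  proof (cases "x = 1 \<and> y = 1 \<and> z = 1")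
    case True
    then have "a = 4" "b = 4" "c = 4" "k = 6" using abc by simp_all
    then show ?thesis
      using landmarks_4_4_5
      by (intro exI[of _ "{(4,3,2),(3,2,2),(1,1,3),(2,4,1),(4,1,4),(2,2,2)}"]) simp
  next
    case False
    from even_landmarks[OF this] show ?thesis unfolding abc .
  qed
next
  case False
  then obtain h where h: "k = 2 * h + 1" by (elim oddE)
  \<comment> \<open>Now \<open>x + y + z = h - 1\<close> and \<open>a = h + 1 + y\<close>; as
    \<open>k\<close> is odd, \<open>k \<le> 2 * a\<close> gives
    \<open>h + 1 \<le> a\<close>.\<close>
  define x y z where "x = c - h - 1" and "y = a - h - 1" and "z = b - h - 1"
  then have abc: "a = 2 * y + z + (x + 2)" "b = y + 2 * z + (x + 2)"
      "c = y + z + (2 * x + 2)" "k = 2 * y + 2 * z + (2 * x + 3)"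
    using assms h by auto
  show ?thesis unfolding abc by (rule odd_landmarks)
qed

theorem theorem2:
  fixes a b c :: nat
  assumes "a > 0" and "b > 0" and "c > 0"
    and "a \<le> b" and "b \<le> c" and "3 * a \<ge> b + c"
  shows "metric_dimension (K3prod a b c) \<le> (a + b + c) div 2"
proof (cases "even (a + b + c)")
  case True
  then have "a + b + c = 2 * ((a + b + c) div 2)" by simp
  moreover from this have "(a + b + c) div 2 \<le> 2 * a" using assms by linarith
  moreover from this have "(a + b + c) div 2 \<le> 2 * b" "(a + b + c) div 2 \<le> 2 * c"
    using assms by linarith+
  ultimately obtain U where U: "U \<subseteq> {1..a} \<times> {1..b} \<times> {1..c}" "landmarks a b (c + 1) U"
      "card U \<le> (a + b + c) div 2"
    using triangle_landmarks[of a b c "(a + b + c) div 2"] by blast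
  from metric_dimension_K3prod_le[OF U(1) landmarks_mono[OF U(2)]] U(3) show ?thesis by simp
next
  case odd: False
  show ?thesis
  proof (cases "c = 1")
    case True
    \<comment> \<open>Here \<open>a = b = c = 1\<close>: a single vertex needs no landmark.\<close>
    then have "landmarks a b c {}" using assms by (auto simp: landmarks_def)
    from metric_dimension_K3prod_le[OF _ this] show ?thesis by simp
  next
    case False
    \<comment> \<open>Landmarks are built for \<open>c - 1\<close>; the last value of the third
      coordinate is the one that no landmark takes.\<close>
    have "a + b + (c - 1) = 2 * ((a + b + c) div 2)"
      using odd_two_times_div_two_succ[OF odd] assms(3) by linarith
    moreover from this have "(a + b + c) div 2 \<le> 2 * a" using assms by linarith
    moreover from this have "(a + b + c) div 2 \<le> 2 * b" using assms by linarith
    moreover have "(a + b + c) div 2 \<le> 2 * (c - 1)"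
    proof -
      have "k \<le> 2 * (c - 1)" if "2 * k + 1 \<le> 3 * c" "2 \<le> c" for k using that by presburger
      moreover have "2 * ((a + b + c) div 2) + 1 \<le> 3 * c" "2 \<le> c"
        using odd False assms(3,4,5) by auto
      ultimately show ?thesis by blast
    qed
    ultimately obtain U where U: "U \<subseteq> {1..a} \<times> {1..b} \<times> {1..c - 1}" "landmarks a b (c - 1 + 1) U"
        "card U \<le> (a + b + c) div 2"
      using triangle_landmarks[of a b "c - 1" "(a + b + c) div 2"] by blast
    have "{1..a} \<times> {1..b} \<times> {1..c - 1} \<subseteq> {1..a} \<times> {1..b} \<times> {1..c}" by auto
    with U(1) have "U \<subseteq> {1..a} \<times> {1..b} \<times> {1..c}" by (rule subset_trans)
    from metric_dimension_K3prod_le[OF this] U(2,3) assms(3) show ?thesis by simp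
  qed
qed

end
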